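(* Let $\psi$ be a symbol and let $\alpha=(\alpha_j)_{j\in\mathbb{N}}$ be an increasing sequence of positive real numbers with $\lim_{j\to\infty}\alpha_j=\infty$, such that the generalized backward shift $B_\psi$ is well-defined on $\Lambda_\infty'(\alpha)$. Then $B_\psi$ is mixing on $\Lambda_\infty'(\alpha)$. Moreover, $B_\psi$ is chaotic on $\Lambda_\infty'(\alpha)$ if, and only if, $\sum_{j=1}^\infty e^{-l\alpha_j}<\infty$ for some $l>0$.
   Context: $\mathbb{N}=\{1,2,\dots\}$, $\mathbb{K}\in\{\mathbb{R},\mathbb{C}\}$, $\omega=\mathbb{K}^{\mathbb{N}}$. A symbol is a bijection $\psi:\mathbb{N}\to\mathbb{N}\setminus\{1\}$ with $\mathbb{N}=\{1\}\cup\bigcup_{n\in\mathbb{N}}\{\psi^n(1)\}$, where $\psi^n$ is the $n$-th iterate. The generalized backward shift is $B_\psi:\omega\to\omega$, $(x_j)_{j\in\mathbb{N}}\mapsto(x_{\psi(j)})_{j\in\mathbb{N}}$. $\Lambda_\infty(\alpha)=\{x\in\omega:\ \sum_{j}|x_j|^2e^{2m\alpha_j}<\infty\ \text{for all } m\in\mathbb{N}\}$ is the power series space of infinite type, and its topological dual $\Lambda_\infty'(\alpha)$ is identified with the sequence space $$k_2\big(((e^{-m\alpha_j})_{j\in\mathbb{N}})_{m\in\mathbb{N}}\big)=\Big\{x\in\omega:\ \exists\,m\in\mathbb{N}:\ \sum_{j=1}^\infty|x_j|^2e^{-2m\alpha_j}<\infty\Big\},$$ equipped with the locally convex inductive limit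 topology of the increasing sequence of Hilbert spaces $\{x\in\omega:\sum_j|x_j|^2e^{-2m\alpha_j}<\infty\}$, $m\in\mathbb{N}$ (the finest locally convex topology making all inclusions of these steps continuous). $B_\psi$ being well-defined on $\Lambda'_\infty(\alpha)$ means that $B_\psi$ maps this sequence space into itself (it is then automatically continuous). For a continuous linear operator $T$ on a topological vector space $E$ and non-empty open $U,W\subseteq E$, let $N_T(U,W)=\{n\in\mathbb{N}:T^n(U)\cap W\ne\emptyset\}$. $T$ is transitive if all $N_T(U,W)$ are non-empty and mixing if they are all cofinite. $T$ is chaotic if it is transitive and the set of points $x$ with $T^Nx=x$ for some $N\in\mathbb{N}$ is dense in $E$. *)

theory Defs
  imports "HOL-Analysis.Analysis"
begin

text \<open>
  Sequences indexed by \<open>{1, 2, \<dots>}\<close> are represented as functions on \<^typ>\<open>nat\<close> with all indices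
  shifted by one; in particular the index \<open>0\<close> plays the role of the first index \<open>1\<close>.  Exponents,
  step numbers, iteration counts and periods are not shifted and range over \<open>{1..}\<close>.

  The scalar field is a type variable of class \<^class>\<open>real_normed_field\<close>.  Both \<^typ>\<open>real\<close> and
  \<^typ>\<open>complex\<close> are instances, and by the Gelfand--Mazur theorem there are no others up to
  isometric isomorphism.
\<close>


subsection \<open>Symbols and generalized backward shifts\<close>

definition is_symbol :: "(nat \<Rightarrow> nat) \<Rightarrow> bool" where
  "is_symbol \<psi> \<longleftrightarrow>
     bij_betw \<psi> UNIV (UNIV - {0}) \<and> UNIV = {0} \<union> (\<Union>n\<in>{1..}. {(\<psi> ^^ n) 0})"

definition gen_backward_shift :: "(nat \<Rightarrow> nat) \<Rightarrow> (nat \<Rightarrow> 'k) \<Rightarrow> (nat \<Rightarrow> 'k)" where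
  "gen_backward_shift \<psi> x = (\<lambda>j. x (\<psi> j))"


subsection \<open>The Hilbert steps\<close>

definition dual_step :: "(nat \<Rightarrow> real) \<Rightarrow> nat \<Rightarrow> (nat \<Rightarrow> 'k::real_normed_field) set" where
  "dual_step \<alpha> m = {x. (\<lambda>j. (norm (x j))\<^sup>2 * exp (- 2 * real m * \<alpha> j)) summable_on UNIV}"

definition step_dist ::
    "(nat \<Rightarrow> real) \<Rightarrow> nat \<Rightarrow> (nat \<Rightarrow> 'k::real_normed_field) \<Rightarrow> (nat \<Rightarrow> 'k) \<Rightarrow> real" where
  "step_dist \<alpha> m x y =
     sqrt (\<Sum>\<^sub>\<infinity>j. (norm (x j - y j))\<^sup>2 * exp (- 2 * real m * \<alpha> j))"

definition step_topology ::
    "(nat \<Rightarrow> real) \<Rightarrow> nat \<Rightarrow> (nat \<Rightarrow> 'k::real_normed_field) topology" where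
  "step_topology \<alpha> m = Metric_space.mtopology (dual_step \<alpha> m) (step_dist \<alpha> m)"

definition dual_space :: "(nat \<Rightarrow> real) \<Rightarrow> (nat \<Rightarrow> 'k::real_normed_field) set" where
  "dual_space \<alpha> = (\<Union>m\<in>{1..}. dual_step \<alpha> m)"


subsection \<open>The locally convex inductive limit topology\<close>

text \<open>
  Function types carry no vector space instance, so the linear structure is written pointwise.
\<close>

definition seq_convex :: "(nat \<Rightarrow> 'k::real_normed_field) set \<Rightarrow> bool" where
  "seq_convex S \<longleftrightarrow>
     (\<forall>x\<in>S. \<forall>y\<in>S. \<forall>t\<in>{0..1::real}. (\<lambda>j. (1 - t) *\<^sub>R x j + t *\<^sub>R y j) \<in> S)"

text \<open>Hausdorffness is not required.\<close>

definition locally_convex_topology_on ::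
    "(nat \<Rightarrow> 'k::real_normed_field) set \<Rightarrow> (nat \<Rightarrow> 'k) topology \<Rightarrow> bool" where
  "locally_convex_topology_on E X \<longleftrightarrow>
     topspace X = E \<and>
     continuous_map (prod_topology X X) X (\<lambda>(x, y). \<lambda>j. x j + y j) \<and>
     continuous_map (prod_topology euclidean X) X (\<lambda>(c, x). \<lambda>j. c * x j) \<and>
     neighbourhood_base_at (\<lambda>_. 0) seq_convex X"

definition step_compatible ::
    "(nat \<Rightarrow> real) \<Rightarrow> (nat \<Rightarrow> 'k::real_normed_field) topology \<Rightarrow> bool" where
  "step_compatible \<alpha> X \<longleftrightarrow>
     locally_convex_topology_on (dual_space \<alpha>) X \<and>
     (\<forall>m\<ge>1. continuous_map (step_topology \<alpha> m) X id)"

text \<open>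
  The supremum of all compatible topologies.  That it is itself compatible, hence the finest
  compatible topology, is shown in \<open>dual_topology_finest\<close> below.
\<close>

definition dual_topology :: "(nat \<Rightarrow> real) \<Rightarrow> (nat \<Rightarrow> 'k::real_normed_field) topology" where
  "dual_topology \<alpha> = topology_generated_by {U. \<exists>X. step_compatible \<alpha> X \<and> openin X U}"


subsection \<open>Dynamics\<close>

definition hitting_times :: "('a \<Rightarrow> 'a) \<Rightarrow> 'a set \<Rightarrow> 'a set \<Rightarrow> nat set" where
  "hitting_times T U W = {n. n \<ge> 1 \<and> (T ^^ n) ` U \<inter> W \<noteq> {}}"

definition transitive_on :: "'a topology \<Rightarrow> ('a \<Rightarrow> 'a) \<Rightarrow> bool" where
  "transitive_on X T \<longleftrightarrow>
     (\<forall>U W. openin X U \<and> U \<noteq> {} \<and> openin X W \<and> W \<noteq> {} \<longrightarrow> hitting_times T U W \<noteq> {})"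

definition mixing_on :: "'a topology \<Rightarrow> ('a \<Rightarrow> 'a) \<Rightarrow> bool" where
  "mixing_on X T \<longleftrightarrow>
     (\<forall>U W. openin X U \<and> U \<noteq> {} \<and> openin X W \<and> W \<noteq> {} \<longrightarrow>
        finite ({1..} - hitting_times T U W))"

definition chaotic_on :: "'a topology \<Rightarrow> ('a \<Rightarrow> 'a) \<Rightarrow> bool" where
  "chaotic_on X T \<longleftrightarrow>
     transitive_on X T \<and>
     X closure_of {x \<in> topspace X. \<exists>N\<ge>1. (T ^^ N) x = x} = topspace X"


subsection \<open>The metric and the inductive limit topology are as intended\<close>

lemma l2_triangle:
  fixes p q r :: "nat \<Rightarrow> real"
  assumes p: "(\<lambda>j. (p j)\<^sup>2) summable_on UNIV" and q: "(\<lambda>j. (q j)\<^sup>2) summable_on UNIV"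
    and nn: "\<And>j. 0 \<le> r j" and le: "\<And>j. r j \<le> p j + q j"
  shows "(\<lambda>j. (r j)\<^sup>2) summable_on UNIV"
    and "sqrt (\<Sum>\<^sub>\<infinity>j. (r j)\<^sup>2) \<le> sqrt (\<Sum>\<^sub>\<infinity>j. (p j)\<^sup>2) + sqrt (\<Sum>\<^sub>\<infinity>j. (q j)\<^sup>2)"
proof -
  define B where "B = sqrt (\<Sum>\<^sub>\<infinity>j. (p j)\<^sup>2) + sqrt (\<Sum>\<^sub>\<infinity>j. (q j)\<^sup>2)"
  have B0: "0 \<le> B"
    unfolding B_def by (intro add_nonneg_nonneg real_sqrt_ge_zero infsum_nonneg) auto
  have fin: "(\<Sum>j\<in>F. (r j)\<^sup>2) \<le> B\<^sup>2" if F: "finite F" for F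
  proof -
    have "L2_set r F \<le> L2_set (\<lambda>j. p j + q j) F"
      by (rule L2_set_mono) (use nn le in auto)
    also have "\<dots> \<le> L2_set p F + L2_set q F"
      by (rule L2_set_triangle_ineq)
    also have "\<dots> \<le> B"
      unfolding B_def L2_set_def
      by (intro add_mono real_sqrt_le_mono finite_sum_le_infsum p q F) auto
    finally have "sqrt (\<Sum>j\<in>F. (r j)\<^sup>2) \<le> B"
      by (simp add: L2_set_def)
    then show ?thesis
      by (rule sqrt_le_D)
  qed
  show s: "(\<lambda>j. (r j)\<^sup>2) summable_on UNIV"
    by (rule nonneg_bdd_above_summable_on) (auto intro!: bdd_aboveI2[where M="B\<^sup>2"] fin)
  have "(\<Sum>\<^sub>\<infinity>j. (r j)\<^sup>2) \<le> B\<^sup>2"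
    by (rule infsum_le_finite_sums[OF s]) (use fin in auto)
  then show "sqrt (\<Sum>\<^sub>\<infinity>j. (r j)\<^sup>2) \<le> sqrt (\<Sum>\<^sub>\<infinity>j. (p j)\<^sup>2) + sqrt (\<Sum>\<^sub>\<infinity>j. (q j)\<^sup>2)"
    using B0 real_le_lsqrt unfolding B_def by blast
qed

lemma weight_square:
  "(norm z)\<^sup>2 * exp (- 2 * real m * a) = (norm z * exp (- (real m * a)))\<^sup>2"
  by (simp add: power_mult_distrib flip: exp_double)

lemma dual_step_add:
  assumes "x \<in> dual_step \<alpha> m" "y \<in> dual_step \<alpha> m"
  shows "(\<lambda>j. x j + y j) \<in> dual_step \<alpha> m"
  using assms unfolding dual_step_def weight_square mem_Collect_eq
  by (rule l2_triangle(1)) (auto simp: norm_triangle_ineq simp flip: distrib_right)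

lemma dual_step_mult:
  assumes "x \<in> dual_step \<alpha> m"
  shows "(\<lambda>j. c * x j) \<in> dual_step \<alpha> m"
  using assms unfolding dual_step_def mem_Collect_eq
  by (auto simp: norm_mult power_mult_distrib mult.assoc intro: summable_on_cmult_right)

lemma dual_step_diff:
  assumes "x \<in> dual_step \<alpha> m" "y \<in> dual_step \<alpha> m"
  shows "(\<lambda>j. x j - y j) \<in> dual_step \<alpha> m"
  using dual_step_add[OF assms(1) dual_step_mult[OF assms(2), of "-1"]] by simp

lemma step_metric:
  "Metric_space (dual_step \<alpha> m :: (nat \<Rightarrow> 'k::real_normed_field) set) (step_dist \<alpha> m)"
proof
  fix x y z :: "nat \<Rightarrow> 'k"
  show "0 \<le> step_dist \<alpha> m x y"
    unfolding step_dist_def by (intro real_sqrt_ge_zero infsum_nonneg) auto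
  show "step_dist \<alpha> m x y = step_dist \<alpha> m y x"
    by (simp add: step_dist_def norm_minus_commute)
  assume x: "x \<in> dual_step \<alpha> m" and y: "y \<in> dual_step \<alpha> m"
  have sxy: "(\<lambda>j. (norm (x j - y j))\<^sup>2 * exp (- 2 * real m * \<alpha> j)) summable_on UNIV"
    using dual_step_diff[OF x y] by (simp add: dual_step_def)
  show "step_dist \<alpha> m x y = 0 \<longleftrightarrow> x = y"
  proof
    assume "step_dist \<alpha> m x y = 0"
    then have "(\<Sum>\<^sub>\<infinity>j. (norm (x j - y j))\<^sup>2 * exp (- 2 * real m * \<alpha> j)) = 0"
      by (simp add: step_dist_def)
    then have "(norm (x j - y j))\<^sup>2 * exp (- 2 * real m * \<alpha> j) = 0" for j
      by (intro nonneg_infsum_le_0D[OF _ sxy]) auto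
    then show "x = y" by auto
  qed (simp add: step_dist_def)
  assume z: "z \<in> dual_step \<alpha> m"
  have syz: "(\<lambda>j. (norm (y j - z j))\<^sup>2 * exp (- 2 * real m * \<alpha> j)) summable_on UNIV"
    using dual_step_diff[OF y z] by (simp add: dual_step_def)
  have tri: "norm (x j - z j) \<le> norm (x j - y j) + norm (y j - z j)" for j
    using norm_triangle_ineq[of "x j - y j" "y j - z j"] by simp
  show "step_dist \<alpha> m x z \<le> step_dist \<alpha> m x y + step_dist \<alpha> m y z"
    unfolding step_dist_def weight_square
    by (rule l2_triangle(2)[OF sxy[unfolded weight_square] syz[unfolded weight_square]])
       (auto simp: tri simp flip: distrib_right)
qed

lemma dual_step_mono:
  assumes "\<And>j. 0 \<le> \<alpha> j" "m \<le> n"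
  shows "dual_step \<alpha> m \<subseteq> dual_step \<alpha> n"
proof
  fix x :: "nat \<Rightarrow> 'k::real_normed_field" assume "x \<in> dual_step \<alpha> m"
  then show "x \<in> dual_step \<alpha> n"
    unfolding dual_step_def mem_Collect_eq
    by (rule summable_on_comparison_test) (use assms in \<open>auto intro!: mult_left_mono mult_right_mono\<close>)
qed

lemma dual_space_add:
  assumes "\<And>j. 0 \<le> \<alpha> j" "x \<in> dual_space \<alpha>" "y \<in> dual_space \<alpha>"
  shows "(\<lambda>j. x j + y j) \<in> dual_space \<alpha>"
proof -
  obtain m n where mn: "m \<ge> 1" "x \<in> dual_step \<alpha> m" "y \<in> dual_step \<alpha> n"
    using assms(2,3) by (auto simp: dual_space_def)
  then have "x \<in> dual_step \<alpha> (max m n)" "y \<in> dual_step \<alpha> (max m n)"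
    using dual_step_mono[OF assms(1), where 'a='a] by (meson max.cobounded1 max.cobounded2 subsetD)+
  with mn show ?thesis
    unfolding dual_space_def by (auto intro!: bexI[of _ "max m n"] dual_step_add)
qed

lemma dual_space_mult:
  "x \<in> dual_space \<alpha> \<Longrightarrow> (\<lambda>j. c * x j) \<in> dual_space \<alpha>"
  by (auto simp: dual_space_def intro: dual_step_mult)

lemma zero_in_dual_space: "(\<lambda>_. 0) \<in> dual_space \<alpha>"
  by (auto simp: dual_space_def dual_step_def)

lemma topspace_step_topology: "topspace (step_topology \<alpha> m) = dual_step \<alpha> m"
  by (simp add: step_topology_def Metric_space.topspace_mtopology[OF step_metric])

lemma step_compatible_indiscrete:
  fixes \<alpha> :: "nat \<Rightarrow> real"
  assumes "\<And>j. 0 \<le> \<alpha> j"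
  defines "X \<equiv> topology_generated_by {dual_space \<alpha> :: (nat \<Rightarrow> 'k::real_normed_field) set}"
  shows "step_compatible \<alpha> X"
proof -
  have X: "topspace X = dual_space \<alpha>" by (simp add: X_def)
  have opn: "U = {} \<or> U = dual_space \<alpha>" if "openin X U" for U
  proof -
    have "generate_topology_on {dual_space \<alpha>} U"
      using that unfolding X_def by (rule openin_topology_generated_by)
    then show ?thesis by induction auto
  qed
  have cont: "continuous_map Y X f" if "\<And>y. y \<in> topspace Y \<Longrightarrow> f y \<in> dual_space \<alpha>"
    for Y :: "'b topology" and f
  proof -
    have "openin Y {y \<in> topspace Y. f y \<in> U}" if "openin X U" for U
      using opn[OF that] \<open>\<And>y. y \<in> topspace Y \<Longrightarrow> f y \<in> dual_space \<alpha>\<close>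
      by (auto cong: conj_cong)
    then show ?thesis
      using that by (auto simp: continuous_map_def X)
  qed
  have cx: "seq_convex (dual_space \<alpha> :: (nat \<Rightarrow> 'k) set)"
    unfolding seq_convex_def
    by (auto simp: scaleR_conv_of_real intro!: dual_space_add dual_space_mult assms(1))
  have "neighbourhood_base_at (\<lambda>_. 0) seq_convex X"
    unfolding neighbourhood_base_at_def using cx opn by blast
  moreover have "id x \<in> dual_space \<alpha>" if "m \<ge> 1" "x \<in> topspace (step_topology \<alpha> m)"
    for m and x :: "nat \<Rightarrow> 'k"
    using that by (auto simp: topspace_step_topology dual_space_def)
  ultimately show ?thesis
    unfolding step_compatible_def locally_convex_topology_on_def
    by (auto simp: X intro!: cont dual_space_add dual_space_mult assms(1))
qed

theorem dual_topology_finest: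
  fixes \<alpha> :: "nat \<Rightarrow> real"
  assumes nn: "\<And>j. 0 \<le> \<alpha> j"
  defines "D \<equiv> (dual_topology \<alpha> :: (nat \<Rightarrow> 'k::real_normed_field) topology)"
  shows "step_compatible \<alpha> D"
    and "step_compatible \<alpha> X \<Longrightarrow> openin X U \<Longrightarrow> openin D U"
proof -
  let ?S = "{U. \<exists>X. step_compatible \<alpha> X \<and> openin X (U :: (nat \<Rightarrow> 'k) set)}"
  show finer: "openin D U" if "step_compatible \<alpha> X" "openin X U" for X U
    unfolding D_def dual_topology_def by (rule topology_generated_by_Basis) (use that in blast)
  have top_eq: "topspace X = dual_space \<alpha>" if "step_compatible \<alpha> X" for X :: "(nat \<Rightarrow> 'k) topology"
    using that by (simp add: step_compatible_def locally_convex_topology_on_def)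
  have US: "\<Union>?S = dual_space \<alpha>"
  proof
    show "\<Union>?S \<subseteq> dual_space \<alpha>"
      using top_eq openin_subset by blast
    have "openin (topology_generated_by {dual_space \<alpha> :: (nat \<Rightarrow> 'k) set}) (dual_space \<alpha>)"
      by (rule topology_generated_by_Basis) simp
    then have "dual_space \<alpha> \<in> ?S"
      using step_compatible_indiscrete[of \<alpha>, where 'k='k, OF nn] by blast
    then show "dual_space \<alpha> \<subseteq> \<Union>?S"
      by (rule Union_upper)
  qed
  then have topD: "topspace D = dual_space \<alpha>"
    by (simp add: D_def dual_topology_def)
  have id_cont: "continuous_map D X id" if "step_compatible \<alpha> X" for X
  proof -
    have "{x \<in> topspace D. id x \<in> U} = U" if "openin X U" for U
      using openin_subset[OF that] top_eq[OF \<open>step_compatible \<alpha> X\<close>] topD by auto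
    with that finer show ?thesis
      by (auto simp: continuous_map_def topD top_eq)
  qed
  have contI: "continuous_map Y D f"
    if f: "\<And>X. step_compatible \<alpha> X \<Longrightarrow> continuous_map Y X f" for Y :: "'b topology" and f
    unfolding D_def dual_topology_def
  proof (rule continuous_on_generated_topo)
    fix U assume "U \<in> ?S"
    then obtain X where "step_compatible \<alpha> X" "openin X U" by auto
    then show "openin Y (f -` U \<inter> topspace Y)"
      using openin_continuous_map_preimage[OF f] by (simp add: vimage_def Int_def conj_commute)
  next
    have "continuous_map Y (topology_generated_by {dual_space \<alpha>}) f"
      by (rule f, rule step_compatible_indiscrete[of \<alpha>, OF nn])
    then show "f ` topspace Y \<subseteq> \<Union>?S"
      unfolding US by (auto simp: continuous_map_def)
  qed
  have add: "continuous_map (prod_topology D D) D (\<lambda>(x, y). \<lambda>j. x j + y j)"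
  proof (rule contI)
    fix X :: "(nat \<Rightarrow> 'k) topology" assume X: "step_compatible \<alpha> X"
    have "continuous_map (prod_topology D D) (prod_topology X X) (\<lambda>(x, y). (id x, id y))"
      by (intro continuous_map_prod_top[THEN iffD2] disjI2 conjI id_cont X)
    moreover have "continuous_map (prod_topology X X) X (\<lambda>(x, y). \<lambda>j. x j + y j)"
      using X by (simp add: step_compatible_def locally_convex_topology_on_def)
    ultimately show "continuous_map (prod_topology D D) X (\<lambda>(x, y). \<lambda>j. x j + y j)"
      using continuous_map_compose by (fastforce simp: o_def case_prod_unfold)
  qed
  have mult: "continuous_map (prod_topology euclidean D) D (\<lambda>(c, x). \<lambda>j. c * x j)"
  proof (rule contI)
    fix X :: "(nat \<Rightarrow> 'k) topology" assume X: "step_compatible \<alpha> X"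
    have "continuous_map (prod_topology euclidean D) (prod_topology euclidean X)
            (\<lambda>(c, x). (id c, id x))"
      by (intro continuous_map_prod_top[THEN iffD2] disjI2 conjI id_cont X continuous_map_id)
    moreover have "continuous_map (prod_topology euclidean X) X (\<lambda>(c, x). \<lambda>j. c * x j)"
      using X by (simp add: step_compatible_def locally_convex_topology_on_def)
    ultimately show "continuous_map (prod_topology euclidean D) X (\<lambda>(c, x). \<lambda>j. c * x j)"
      using continuous_map_compose by (fastforce simp: o_def case_prod_unfold)
  qed
  have nbhd: "\<exists>U V. openin D U \<and> seq_convex V \<and> (\<lambda>_. 0) \<in> U \<and> U \<subseteq> V \<and> V \<subseteq> W"
    if "generate_topology_on ?S W" "(\<lambda>_. 0) \<in> W" for W
    using that
  proof induction
    case Empty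
    then show ?case by simp
  next
    case (Int a b)
    obtain U V where U: "openin D U" "seq_convex V" "(\<lambda>_. 0) \<in> U" "U \<subseteq> V" "V \<subseteq> a"
      using Int.IH(1) Int.prems by auto
    obtain U' V' where U': "openin D U'" "seq_convex V'" "(\<lambda>_. 0) \<in> U'" "U' \<subseteq> V'" "V' \<subseteq> b"
      using Int.IH(2) Int.prems by auto
    have "seq_convex (V \<inter> V')"
      using U(2) U'(2) by (simp add: seq_convex_def)
    then show ?case
      using U U' by (intro exI[of _ "U \<inter> U'"] exI[of _ "V \<inter> V'"]) auto
  next
    case (UN K)
    then obtain k where k: "k \<in> K" "(\<lambda>_. 0) \<in> k" by blast
    obtain U V where "openin D U" "seq_convex V" "(\<lambda>_. 0) \<in> U" "U \<subseteq> V" "V \<subseteq> k"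
      using UN.IH[OF k] by auto
    with k(1) show ?case by (intro exI[of _ U] exI[of _ V]) auto
  next
    case (Basis s)
    then obtain X where X: "step_compatible \<alpha> X" "openin X s" by auto
    then have "neighbourhood_base_at (\<lambda>_. 0) seq_convex X"
      by (simp add: step_compatible_def locally_convex_topology_on_def)
    then obtain U V where "openin X U" "seq_convex V" "(\<lambda>_. 0) \<in> U" "U \<subseteq> V" "V \<subseteq> s"
      using X(2) Basis.prems unfolding neighbourhood_base_at_def by blast
    with finer[OF X(1)] show ?case by (intro exI[of _ U] exI[of _ V]) auto
  qed
  have "neighbourhood_base_at (\<lambda>_. 0) seq_convex D"
    unfolding neighbourhood_base_at_def
  proof (intro allI impI)
    fix W assume W: "openin D W \<and> (\<lambda>_. 0) \<in> W"
    then have "generate_topology_on ?S W"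
      unfolding D_def dual_topology_def using openin_topology_generated_by by blast
    with W show "\<exists>U V. openin D U \<and> seq_convex V \<and> (\<lambda>_. 0) \<in> U \<and> U \<subseteq> V \<and> V \<subseteq> W"
      by (intro nbhd) auto
  qed
  then show "step_compatible \<alpha> D"
    unfolding step_compatible_def locally_convex_topology_on_def
    using topD add mult by (auto intro!: contI simp: step_compatible_def)
qed

end

theory Submission
  imports Defs
begin

text \<open>
  Write \<open>s n = (\<psi> ^^ n) 0\<close>.  As \<open>\<psi>\<close> is a symbol, \<open>s\<close> is a bijection of the index set, and along
  this enumeration \<open>gen_backward_shift \<psi>\<close> is the ordinary backward shift:
  \<open>(B x) (s n) = x (s (Suc n))\<close>.

  About the inductive limit topology only two things are needed.  A neighbourhood of \<open>u\<close> contains,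
  for every step to which \<open>u\<close> belongs, a ball of that step around \<open>u\<close>
  (\<open>dual_open_step_ball\<close>); in particular the finitely supported sequences are dense
  (\<open>finite_support_dense\<close>).  And each coordinate is continuous (\<open>openin_coordinate_nonzero\<close>),
  because the topology of a single coordinate is among the compatible ones.

  Mixing.  Let \<open>u \<in> U\<close> and \<open>w \<in> W\<close> be finitely supported, and let \<open>z n\<close> be \<open>w\<close> shifted forward by
  \<open>n\<close> places along \<open>s\<close>.  Since \<open>\<alpha>\<close> tends to infinity and \<open>s\<close> is injective, \<open>z n\<close> tends to \<open>0\<close> in
  the first step, so \<open>u + z n \<in> U\<close> for large \<open>n\<close>; and \<open>B ^^ n\<close> maps \<open>u + z n\<close> to \<open>w\<close> as soon as it
  annihilates \<open>u\<close>.  The continuity of \<open>B\<close> plays no role.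

  Chaos.  If \<open>\<Sum>j. exp (- l * \<alpha> j)\<close> converges, then every bounded sequence lies in every step \<open>m \<ge> l\<close>, and
  the sequences that agree with a finitely supported \<open>u\<close> at \<open>s 0, \<dots>, s (N - 1)\<close> and are repeated
  with period \<open>N\<close> along \<open>s\<close> converge to \<open>u\<close> in these steps as \<open>N\<close> grows
  (\<open>periodic_points_dense\<close>).  Conversely, density yields a periodic point \<open>x\<close> with \<open>x 0 \<noteq> 0\<close>; as
  \<open>x (s (k * N)) = x 0\<close> for all \<open>k\<close>, the sum \<open>\<Sum>k. exp (- 2 * m * \<alpha> (s (k * N)))\<close> converges for some
  \<open>m\<close>.  To pass from the progression \<open>k * N\<close> to all indices, \<open>symbol_growth\<close> extracts from the
  invariance of the space a constant \<open>A\<close> with \<open>\<alpha> (\<psi> j) \<le> A * \<alpha> j\<close>, so that the values of \<open>\<alpha>\<close> at the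
  \<open>N\<close> indices preceding \<open>s (k * N)\<close> are at least \<open>\<alpha> (s (k * N)) / A ^ N\<close>
  (\<open>periodic_point_imp_summable\<close>).
\<close>

section \<open>Neighbourhoods in the inductive limit topology\<close>

lemma dual_open_step_ball:
  fixes u :: "nat \<Rightarrow> 'k::real_normed_field"
  assumes nn: "\<And>j. 0 \<le> \<alpha> j" and U: "openin (dual_topology \<alpha>) U" "u \<in> U"
    and u: "u \<in> dual_step \<alpha> m" and m: "m \<ge> 1"
  obtains \<epsilon> where "\<epsilon> > 0"
    "\<And>z. z \<in> dual_step \<alpha> m \<Longrightarrow> (\<Sum>\<^sub>\<infinity>j. (norm (z j))\<^sup>2 * exp (- 2 * real m * \<alpha> j)) < \<epsilon> \<Longrightarrow>
       (\<lambda>j. u j + z j) \<in> U"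
proof -
  interpret Metric_space "dual_step \<alpha> m :: (nat \<Rightarrow> 'k) set" "step_dist \<alpha> m"
    by (rule step_metric)
  have "continuous_map (step_topology \<alpha> m) (dual_topology \<alpha> :: (nat \<Rightarrow> 'k) topology) id"
    using dual_topology_finest(1)[of \<alpha>, where 'k='k, OF nn] m by (auto simp: step_compatible_def)
  from openin_continuous_map_preimage[OF this U(1)]
  have "openin mtopology {x \<in> dual_step \<alpha> m. x \<in> U}"
    by (simp add: topspace_step_topology step_topology_def)
  then obtain r where r: "r > 0" "mball u r \<subseteq> {x \<in> dual_step \<alpha> m. x \<in> U}"
    using U(2) u by (force simp: openin_mtopology)
  show thesis
  proof (rule that[of "r\<^sup>2"])
    show "r\<^sup>2 > 0" using r by simp
    fix z :: "nat \<Rightarrow> 'k"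
    assume z: "z \<in> dual_step \<alpha> m"
      and lt: "(\<Sum>\<^sub>\<infinity>j. (norm (z j))\<^sup>2 * exp (- 2 * real m * \<alpha> j)) < r\<^sup>2"
    have "step_dist \<alpha> m u (\<lambda>j. u j + z j) < r"
      using lt r(1) by (simp add: step_dist_def real_less_lsqrt)
    then have "(\<lambda>j. u j + z j) \<in> mball u r"
      using dual_step_add[OF u z] u by simp
    then show "(\<lambda>j. u j + z j) \<in> U" using r(2) by blast
  qed
qed

text \<open>
  Dominated convergence in the form used below: one finite set works for all functions dominated
  by \<open>f\<close>.
\<close>

lemma dominated_infsum_small:
  fixes f :: "nat \<Rightarrow> real"
  assumes f: "f summable_on UNIV" and f0: "\<And>j. 0 \<le> f j" and e: "\<epsilon> > 0"
  obtains F where "finite F"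
    "\<And>g. (\<And>j. 0 \<le> g j) \<Longrightarrow> (\<And>j. g j \<le> f j) \<Longrightarrow> (\<And>j. j \<in> F \<Longrightarrow> g j = 0) \<Longrightarrow>
       g summable_on UNIV \<and> infsum g UNIV < \<epsilon>"
proof -
  obtain F where F: "finite F" and "dist (sum f F) (infsum f UNIV) \<le> \<epsilon> / 2"
    using infsum_finite_approximation[OF f, of "\<epsilon> / 2"] e by auto
  then have small: "infsum f UNIV - sum f F < \<epsilon>"
    using e unfolding dist_real_def by linarith
  show thesis
  proof (rule that[OF F])
    fix g :: "nat \<Rightarrow> real"
    assume g: "\<And>j. 0 \<le> g j" "\<And>j. g j \<le> f j" "\<And>j. j \<in> F \<Longrightarrow> g j = 0"
    have s: "g summable_on UNIV"
      by (rule summable_on_comparison_test[OF f]) (use g in auto)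
    have fF: "f summable_on (UNIV - F)"
      using f F by (simp add: summable_on_cofin_subset)
    have "infsum g UNIV = infsum g (UNIV - F)"
      by (rule infsum_cong_neutral) (use g in auto)
    also have "\<dots> \<le> infsum f (UNIV - F)"
      by (rule infsum_mono) (use g s F fF in \<open>auto simp: summable_on_cofin_subset\<close>)
    also have "\<dots> = infsum f UNIV - sum f F"
      using infsum_Diff[OF f, of F] F by auto
    finally show "g summable_on UNIV \<and> infsum g UNIV < \<epsilon>" using s small by simp
  qed
qed

text \<open>
  The two approximations in step \<open>m\<close>, truncation and periodization, are both instances of this:
  if the weighted squares of a perturbation have a summable majorant \<open>f\<close>, then the perturbed
  sequence stays in \<open>U\<close> as soon as the perturbation vanishes on a finite set depending on \<open>f\<close>.
\<close>

lemma dual_open_dominated: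
  fixes u :: "nat \<Rightarrow> 'k::real_normed_field"
  assumes "\<And>j. 0 \<le> \<alpha> j" "openin (dual_topology \<alpha>) U" "u \<in> U"
    and "u \<in> dual_step \<alpha> m" "m \<ge> 1"
    and f: "f summable_on UNIV" "\<And>j. 0 \<le> f j"
  obtains F where "finite F"
    "\<And>z. (\<And>j. (norm (z j))\<^sup>2 * exp (- 2 * real m * \<alpha> j) \<le> f j) \<Longrightarrow>
       (\<And>j. j \<in> F \<Longrightarrow> z j = 0) \<Longrightarrow> (\<lambda>j. u j + z j) \<in> U"
proof -
  obtain \<epsilon> where e: "\<epsilon> > 0"
    "\<And>z. z \<in> dual_step \<alpha> m \<Longrightarrow> (\<Sum>\<^sub>\<infinity>j. (norm (z j))\<^sup>2 * exp (- 2 * real m * \<alpha> j)) < \<epsilon> \<Longrightarrow>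
       (\<lambda>j. u j + z j) \<in> U"
    by (rule dual_open_step_ball[OF assms(1-5)]) blast
  obtain F where F: "finite F"
    "\<And>g. (\<And>j. 0 \<le> g j) \<Longrightarrow> (\<And>j. g j \<le> f j) \<Longrightarrow> (\<And>j. j \<in> F \<Longrightarrow> g j = 0) \<Longrightarrow>
       g summable_on UNIV \<and> infsum g UNIV < \<epsilon>"
    by (rule dominated_infsum_small[OF f e(1)]) blast
  show thesis
  proof (rule that[OF F(1)])
    fix z :: "nat \<Rightarrow> 'k"
    assume z: "\<And>j. (norm (z j))\<^sup>2 * exp (- 2 * real m * \<alpha> j) \<le> f j" "\<And>j. j \<in> F \<Longrightarrow> z j = 0"
    have "(\<lambda>j. (norm (z j))\<^sup>2 * exp (- 2 * real m * \<alpha> j)) summable_on UNIV \<and>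
          (\<Sum>\<^sub>\<infinity>j. (norm (z j))\<^sup>2 * exp (- 2 * real m * \<alpha> j)) < \<epsilon>"
      by (rule F(2)) (use z in auto)
    then show "(\<lambda>j. u j + z j) \<in> U"
      by (intro e(2)) (auto simp: dual_step_def)
  qed
qed

lemma finite_support_in_dual_step:
  assumes "finite {j. x j \<noteq> 0}"
  shows "x \<in> dual_step \<alpha> m"
proof -
  have "(\<lambda>j. (norm (x j))\<^sup>2 * exp (- 2 * real m * \<alpha> j)) summable_on {j. x j \<noteq> 0}"
    using assms by simp
  moreover have "?this \<longleftrightarrow> (\<lambda>j. (norm (x j))\<^sup>2 * exp (- 2 * real m * \<alpha> j)) summable_on UNIV"
    by (rule summable_on_cong_neutral) auto
  ultimately show ?thesis by (simp add: dual_step_def)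
qed

lemma topspace_dual_topology:
  assumes "\<And>j. 0 \<le> \<alpha> j"
  shows "topspace (dual_topology \<alpha> :: (nat \<Rightarrow> 'k::real_normed_field) topology) = dual_space \<alpha>"
  using dual_topology_finest(1)[of \<alpha>, where 'k='k, OF assms]
  by (simp add: step_compatible_def locally_convex_topology_on_def)

lemma finite_support_dense:
  fixes U :: "(nat \<Rightarrow> 'k::real_normed_field) set"
  assumes nn: "\<And>j. 0 \<le> \<alpha> j" and U: "openin (dual_topology \<alpha>) U" "U \<noteq> {}"
  obtains x where "x \<in> U" "finite {j. x j \<noteq> 0}"
proof -
  obtain u where u: "u \<in> U" using U by blast
  then have "u \<in> dual_space \<alpha>"
    using openin_subset[OF U(1)] topspace_dual_topology[of \<alpha>, where 'k='k, OF nn] by auto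
  then obtain m where m: "m \<ge> 1" "u \<in> dual_step \<alpha> m" by (auto simp: dual_space_def)
  have s: "(\<lambda>j. (norm (u j))\<^sup>2 * exp (- 2 * real m * \<alpha> j)) summable_on UNIV"
    using m by (simp add: dual_step_def)
  obtain F where F: "finite F"
    "\<And>z. (\<And>j. (norm (z j))\<^sup>2 * exp (- 2 * real m * \<alpha> j) \<le> (norm (u j))\<^sup>2 * exp (- 2 * real m * \<alpha> j)) \<Longrightarrow>
       (\<And>j. j \<in> F \<Longrightarrow> z j = 0) \<Longrightarrow> (\<lambda>j. u j + z j) \<in> U"
    by (rule dual_open_dominated[OF nn U(1) u m(2,1) s]) auto
  have "(\<lambda>j. u j + (if j \<in> F then 0 else - u j)) \<in> U"
    by (rule F(2)) auto
  moreover have "finite {j. u j + (if j \<in> F then 0 else - u j) \<noteq> 0}"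
    by (rule finite_subset[OF _ F(1)]) (auto split: if_splits)
  ultimately show thesis by (rule that)
qed

text \<open>
  The initial topology of the single functional \<open>x \<mapsto> x i\<close> is locally convex (though not Hausdorff)
  and induces on each step a topology coarser than that of the norm; hence it is coarser than the
  inductive limit topology.
\<close>

lemma coordinate_topology_step_compatible:
  fixes \<alpha> :: "nat \<Rightarrow> real" and i :: nat
  assumes nn: "\<And>j. 0 \<le> \<alpha> j"
  defines "X \<equiv> pullback_topology (dual_space \<alpha> :: (nat \<Rightarrow> 'k::real_normed_field) set) (\<lambda>x. x i) euclidean"
  shows "step_compatible \<alpha> X"
proof -
  have top: "topspace X = dual_space \<alpha>" by (simp add: X_def topspace_pullback_topology)
  have coord: "continuous_map X euclidean (\<lambda>x. x i)"
    unfolding X_def using continuous_map_pullback[OF continuous_map_id, of "dual_space \<alpha>" "\<lambda>x. x i" euclidean]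
    by (simp add: o_def)
  have contI: "continuous_map Y X f"
    if "continuous_map Y euclidean (\<lambda>y. f y i)" "\<And>y. y \<in> topspace Y \<Longrightarrow> f y \<in> dual_space \<alpha>"
    for Y :: "'b topology" and f
    unfolding X_def by (rule continuous_map_pullback') (use that in \<open>auto simp: o_def\<close>)
  have add: "continuous_map (prod_topology X X) X (\<lambda>(x, y). \<lambda>j. x j + y j)"
  proof (rule contI)
    have "continuous_map (prod_topology X X) euclidean (\<lambda>p. fst p i + snd p i)"
      using continuous_map_compose[OF continuous_map_fst coord]
        continuous_map_compose[OF continuous_map_snd coord]
      by (intro continuous_map_add) (auto simp: o_def)
    then show "continuous_map (prod_topology X X) euclidean (\<lambda>y. (case y of (x, y) \<Rightarrow> \<lambda>j. x j + y j) i)"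
      by (simp add: case_prod_unfold)
  qed (auto simp: top intro: dual_space_add nn)
  have mult: "continuous_map (prod_topology euclidean X) X (\<lambda>(c, x). \<lambda>j. c * x j)"
  proof (rule contI)
    have pair: "continuous_map (prod_topology (euclidean :: 'k topology) X)
        (prod_topology euclidean euclidean) (\<lambda>p. (fst p, snd p i))"
      using continuous_map_fst continuous_map_compose[OF continuous_map_snd coord]
      by (intro continuous_map_pairedI) (auto simp: o_def)
    have prod: "continuous_map (prod_topology euclidean euclidean) euclidean (\<lambda>p::'k \<times> 'k. fst p * snd p)"
      by (simp add: euclidean_product_topology continuous_on_fst continuous_on_snd continuous_on_mult)
    show "continuous_map (prod_topology euclidean X) euclidean (\<lambda>y. (case y of (c, x) \<Rightarrow> \<lambda>j. c * x j) i)"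
      using continuous_map_compose[OF pair prod] by (simp add: case_prod_unfold o_def)
  qed (auto simp: top intro: dual_space_mult)
  have nbhd: "neighbourhood_base_at (\<lambda>_. 0) seq_convex X"
    unfolding neighbourhood_base_at_def
  proof (intro allI impI)
    fix W assume W: "openin X W \<and> (\<lambda>_. 0) \<in> W"
    then obtain V where V: "open V" "W = (\<lambda>x. x i) -` V \<inter> dual_space \<alpha>"
      by (auto simp: X_def openin_pullback_topology)
    then obtain e where e: "e > 0" "ball 0 e \<subseteq> V"
      using W by (auto simp: open_contains_ball)
    define C where "C = (\<lambda>x. x i) -` ball 0 e \<inter> (dual_space \<alpha> :: (nat \<Rightarrow> 'k) set)"
    have "openin X C" unfolding X_def openin_pullback_topology C_def by (metis open_ball open_openin)
    moreover have "seq_convex C"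
      unfolding seq_convex_def
    proof (intro ballI)
      fix x y and t :: real assume x: "x \<in> C" and y: "y \<in> C" and t: "t \<in> {0..1}"
      have "(1 - t) *\<^sub>R x i + t *\<^sub>R y i \<in> ball 0 e"
        by (rule convexD[OF convex_ball]) (use x y t in \<open>auto simp: C_def\<close>)
      moreover have "(\<lambda>j. (1 - t) *\<^sub>R x j + t *\<^sub>R y j) \<in> dual_space \<alpha>"
        using x y by (auto simp: C_def scaleR_conv_of_real intro!: dual_space_add dual_space_mult nn)
      ultimately show "(\<lambda>j. (1 - t) *\<^sub>R x j + t *\<^sub>R y j) \<in> C" by (simp add: C_def)
    qed
    moreover have "(\<lambda>_. 0) \<in> C" "C \<subseteq> W"
      using e V zero_in_dual_space by (auto simp: C_def)
    ultimately show "\<exists>U V. openin X U \<and> seq_convex V \<and> (\<lambda>_. 0) \<in> U \<and> U \<subseteq> V \<and> V \<subseteq> W"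
      by blast
  qed
  have "continuous_map (step_topology \<alpha> m) X id" if m: "m \<ge> 1" for m
  proof (rule contI)
    interpret S: Metric_space "dual_step \<alpha> m :: (nat \<Rightarrow> 'k) set" "step_dist \<alpha> m"
      by (rule step_metric)
    have bound: "dist (x i) (y i) * exp (- (real m * \<alpha> i)) \<le> step_dist \<alpha> m x y"
      if "x \<in> dual_step \<alpha> m" "y \<in> dual_step \<alpha> m" for x y :: "nat \<Rightarrow> 'k"
    proof -
      have "(\<lambda>j. (norm (x j - y j))\<^sup>2 * exp (- 2 * real m * \<alpha> j)) summable_on UNIV"
        using dual_step_diff[OF that] by (simp add: dual_step_def)
      from finite_sum_le_infsum[OF this, of "{i}"]
      have "(norm (x i - y i))\<^sup>2 * exp (- 2 * real m * \<alpha> i)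
          \<le> (\<Sum>\<^sub>\<infinity>j. (norm (x j - y j))\<^sup>2 * exp (- 2 * real m * \<alpha> j))" by simp
      then show ?thesis
        unfolding step_dist_def dist_norm weight_square by (rule real_le_rsqrt)
    qed
    have "openin S.mtopology {x \<in> dual_step \<alpha> m. x i \<in> V}" if V: "open V" for V
      unfolding S.openin_mtopology
    proof (intro conjI allI impI)
      fix x assume x: "x \<in> {x \<in> dual_step \<alpha> m. x i \<in> V}"
      then obtain e where e: "e > 0" "ball (x i) e \<subseteq> V"
        using V by (auto simp: open_contains_ball)
      have "S.mball x (e * exp (- (real m * \<alpha> i))) \<subseteq> {x \<in> dual_step \<alpha> m. x i \<in> V}"
      proof
        fix y assume y: "y \<in> S.mball x (e * exp (- (real m * \<alpha> i)))"
        then have "dist (x i) (y i) * exp (- (real m * \<alpha> i)) < e * exp (- (real m * \<alpha> i))"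
          using bound[of x y] unfolding S.in_mball by linarith
        then have "dist (x i) (y i) < e" by simp
        then show "y \<in> {x \<in> dual_step \<alpha> m. x i \<in> V}" using e y by auto
      qed
      then show "\<exists>r>0. S.mball x r \<subseteq> {x \<in> dual_step \<alpha> m. x i \<in> V}"
        using e by (intro exI[of _ "e * exp (- (real m * \<alpha> i))"]) auto
    qed auto
    then show "continuous_map (step_topology \<alpha> m) euclidean (\<lambda>x :: nat \<Rightarrow> 'k. id x i)"
      by (auto simp: continuous_map_def step_topology_def)
  qed (use m in \<open>auto simp: topspace_step_topology dual_space_def\<close>)
  with top add mult nbhd show ?thesis
    by (simp add: step_compatible_def locally_convex_topology_on_def)
qed

lemma openin_coordinate_nonzero:
  assumes "\<And>j. 0 \<le> \<alpha> j"
  shows "openin (dual_topology \<alpha>) {x \<in> dual_space \<alpha>. x i \<noteq> (0 :: 'k::real_normed_field)}"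
proof (rule dual_topology_finest(2)[OF assms coordinate_topology_step_compatible[OF assms, where i = i]])
  show "openin (pullback_topology (dual_space \<alpha>) (\<lambda>x. x i) euclidean)
          {x \<in> dual_space \<alpha>. x i \<noteq> (0 :: 'k)}"
    unfolding openin_pullback_topology by (intro exI[of _ "- {0}"]) auto
qed


section \<open>Orbits of symbols\<close>

lemma bij_symbol_orbit:
  assumes "is_symbol \<psi>"
  shows "bij (\<lambda>n. (\<psi> ^^ n) 0)"
proof (rule bijI)
  have inj: "inj \<psi>" and ne: "\<And>j. \<psi> j \<noteq> 0" and cov: "UNIV = {0} \<union> (\<Union>n\<in>{1..}. {(\<psi> ^^ n) 0})"
    using assms by (auto simp: is_symbol_def bij_betw_def)
  have "(\<psi> ^^ n) 0 \<noteq> (\<psi> ^^ k) 0" if "n < k" for n k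
  proof
    assume eq: "(\<psi> ^^ n) 0 = (\<psi> ^^ k) 0"
    define d where "d = k - n - 1"
    have "k = n + Suc d" using that by (simp add: d_def)
    then have "(\<psi> ^^ n) 0 = (\<psi> ^^ n) ((\<psi> ^^ Suc d) 0)" using eq by (metis comp_apply funpow_add)
    then have "0 = (\<psi> ^^ Suc d) 0" by (rule injD[OF inj_fn[OF inj]])
    then show False using ne by simp
  qed
  then show "inj (\<lambda>n. (\<psi> ^^ n) 0)"
    by (rule linorder_injI)
  have "y \<in> range (\<lambda>n. (\<psi> ^^ n) 0)" for y
  proof -
    have "y \<in> {0} \<union> (\<Union>n\<in>{1..}. {(\<psi> ^^ n) 0})" by (subst cov[symmetric]) (rule UNIV_I)
    then have "y = (\<psi> ^^ 0) 0 \<or> (\<exists>n. y = (\<psi> ^^ n) 0)" by auto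
    then show ?thesis by blast
  qed
  then show "surj (\<lambda>n. (\<psi> ^^ n) 0)" by blast
qed

lemma gen_backward_shift_funpow:
  "(gen_backward_shift \<psi> ^^ n) x = (\<lambda>j. x ((\<psi> ^^ n) j))"
  by (induction n arbitrary: x) (auto simp: gen_backward_shift_def funpow_swap1)

lemma finite_support_orbit:
  fixes x :: "nat \<Rightarrow> 'a::zero"
  assumes s: "bij s" and x: "finite {j. x j \<noteq> 0}"
  obtains K :: nat where "\<And>i. i \<ge> K \<Longrightarrow> x (s i) = 0"
proof -
  have "finite (s -` {j. x j \<noteq> 0})"
    using x s by (intro finite_vimageI) (auto simp: bij_def)
  then obtain K where "\<forall>i\<in>s -` {j. x j \<noteq> 0}. i < K"
    using finite_nat_set_iff_bounded by blast
  then show thesis using that[of K] by force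
qed


section \<open>Mixing\<close>

lemma gen_backward_shift_mixing:
  fixes \<psi> :: "nat \<Rightarrow> nat" and \<alpha> :: "nat \<Rightarrow> real"
  assumes sym: "is_symbol \<psi>" and nn: "\<And>j. 0 \<le> \<alpha> j" and lim: "filterlim \<alpha> at_top sequentially"
  shows "mixing_on (dual_topology \<alpha> :: (nat \<Rightarrow> 'k::real_normed_field) topology) (gen_backward_shift \<psi>)"
  unfolding mixing_on_def
proof (intro allI impI)
  fix U W :: "(nat \<Rightarrow> 'k) set"
  assume "openin (dual_topology \<alpha>) U \<and> U \<noteq> {} \<and> openin (dual_topology \<alpha>) W \<and> W \<noteq> {}"
  then have U: "openin (dual_topology \<alpha>) U" "U \<noteq> {}" and W: "openin (dual_topology \<alpha>) W" "W \<noteq> {}"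
    by auto
  define s where "s n = (\<psi> ^^ n) 0" for n
  have bs: "bij s" using bij_symbol_orbit[OF sym] by (simp add: s_def[abs_def])
  then have inj: "inj s" and surj: "surj s" by (auto simp: bij_def)
  obtain u where u: "u \<in> U" "finite {j. u j \<noteq> 0}" using finite_support_dense[OF nn U] .
  obtain w where w: "w \<in> W" "finite {j. w j \<noteq> 0}" using finite_support_dense[OF nn W] .
  obtain Ku where Ku: "\<And>i. i \<ge> Ku \<Longrightarrow> u (s i) = 0" by (rule finite_support_orbit[OF bs u(2)]) blast
  obtain Kw where Kw: "\<And>i. i \<ge> Kw \<Longrightarrow> w (s i) = 0" by (rule finite_support_orbit[OF bs w(2)]) blast
  \<comment> \<open>\<open>z n\<close> is the \<open>n\<close>-th forward shift of \<open>w\<close> along the orbit, so that \<open>B ^^ n\<close> maps it to \<open>w\<close>.\<close>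
  define z where "z n j = (if inv s j \<ge> n then w (s (inv s j - n)) else 0)" for n j
  have z_s: "z n (s i) = (if i \<ge> n then w (s (i - n)) else 0)" for n i
    by (simp add: z_def inj inv_f_f)
  have z_supp: "j \<in> (\<lambda>i. s (i + n)) ` {..<Kw}" if "z n j \<noteq> 0" for n j
  proof -
    obtain i where i: "j = s i" using surj by blast
    with that have "i \<ge> n" "w (s (i - n)) \<noteq> 0"
      by (auto simp: z_s split: if_splits)
    then have "i \<ge> n" "i - n < Kw" using Kw not_le by blast+
    then show ?thesis using i by (intro image_eqI[of _ _ "i - n"]) auto
  qed
  have z_fin: "finite {j. z n j \<noteq> 0}" for n
    by (rule finite_subset[of _ "(\<lambda>i. s (i + n)) ` {..<Kw}"]) (use z_supp in auto)
  have z_sum: "(\<Sum>\<^sub>\<infinity>j. (norm (z n j))\<^sup>2 * exp (- 2 * real 1 * \<alpha> j)) =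
      (\<Sum>i<Kw. (norm (w (s i)))\<^sup>2 * exp (- 2 * \<alpha> (s (i + n))))" for n
  proof -
    have "(\<Sum>\<^sub>\<infinity>j. (norm (z n j))\<^sup>2 * exp (- 2 * real 1 * \<alpha> j)) =
        (\<Sum>\<^sub>\<infinity>j\<in>(\<lambda>i. s (i + n)) ` {..<Kw}. (norm (z n j))\<^sup>2 * exp (- 2 * real 1 * \<alpha> j))"
      using z_supp[of n] by (intro infsum_cong_neutral) force+
    also have "\<dots> = (\<Sum>i<Kw. (norm (z n (s (i + n))))\<^sup>2 * exp (- 2 * \<alpha> (s (i + n))))"
      by (subst infsum_finite) (auto intro!: sum.reindex_cong[OF _ refl] inj_onI dest: injD[OF inj])
    finally show ?thesis by (simp add: z_s)
  qed
  \<comment> \<open>The support of \<open>z n\<close> moves off to infinity, where the weights tend to \<open>0\<close>.\<close>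
  have "filterlim s at_top sequentially"
    unfolding filterlim_at_top eventually_sequentially
  proof
    fix c
    have "finite (s -` {..<c})" using inj by (intro finite_vimageI) auto
    then obtain b where "s -` {..<c} \<subseteq> {..<b}" using finite_nat_iff_bounded by blast
    then have "c \<le> s n" if "b \<le> n" for n using that by (force simp: not_le[symmetric])
    then show "\<exists>b. \<forall>n\<ge>b. c \<le> s n" by blast
  qed
  then have "filterlim (\<lambda>n. s (i + n)) at_top sequentially" for i
    using filterlim_compose[OF _ filterlim_add_const_nat_at_top[of i]] by (simp add: add.commute)
  then have "filterlim (\<lambda>n. \<alpha> (s (i + n))) at_top sequentially" for i
    by (rule filterlim_compose[OF lim])
  then have "(\<lambda>n. exp (- 2 * \<alpha> (s (i + n)))) \<longlonglongrightarrow> 0" for i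
    by (intro filterlim_compose[OF exp_at_bot] filterlim_tendsto_neg_mult_at_bot[OF tendsto_const]) auto
  then have "(\<lambda>n. \<Sum>i<Kw. (norm (w (s i)))\<^sup>2 * exp (- 2 * \<alpha> (s (i + n)))) \<longlonglongrightarrow> (\<Sum>i<Kw. (norm (w (s i)))\<^sup>2 * 0)"
    by (intro tendsto_sum tendsto_mult tendsto_const)
  then have z_lim: "(\<lambda>n. \<Sum>\<^sub>\<infinity>j. (norm (z n j))\<^sup>2 * exp (- 2 * real 1 * \<alpha> j)) \<longlonglongrightarrow> 0"
    unfolding z_sum by simp
  obtain \<epsilon> where e: "\<epsilon> > 0"
    "\<And>z. z \<in> dual_step \<alpha> 1 \<Longrightarrow> (\<Sum>\<^sub>\<infinity>j. (norm (z j))\<^sup>2 * exp (- 2 * real 1 * \<alpha> j)) < \<epsilon> \<Longrightarrow>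
       (\<lambda>j. u j + z j) \<in> U"
    by (rule dual_open_step_ball[OF nn U(1) u(1) finite_support_in_dual_step[OF u(2)] order_refl]) blast
  obtain N where N: "\<And>n. n \<ge> N \<Longrightarrow> (\<Sum>\<^sub>\<infinity>j. (norm (z n j))\<^sup>2 * exp (- 2 * real 1 * \<alpha> j)) < \<epsilon>"
    using order_tendstoD(2)[OF z_lim e(1)] by (auto simp: eventually_sequentially)
  have "n \<in> hitting_times (gen_backward_shift \<psi>) U W" if n: "n \<ge> 1" "n \<ge> N" "n \<ge> Ku" for n
  proof -
    define y where "y = (\<lambda>j. u j + z n j)"
    have yU: "y \<in> U"
      unfolding y_def using z_fin N n by (intro e(2) finite_support_in_dual_step) auto
    have "(gen_backward_shift \<psi> ^^ n) y j = w j" for j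
    proof -
      obtain i where i: "j = s i" using surj by blast
      have "(\<psi> ^^ n) j = s (i + n)" unfolding i s_def by (simp add: funpow_add add.commute[of i])
      then show ?thesis
        using Ku[of "i + n"] n by (simp add: gen_backward_shift_funpow y_def z_s i)
    qed
    then have "(gen_backward_shift \<psi> ^^ n) y = w" by blast
    then show ?thesis using yU w(1) n by (auto simp: hitting_times_def)
  qed
  then have "{1..} - hitting_times (gen_backward_shift \<psi>) U W \<subseteq> {..<max N Ku}"
    by (auto simp: not_le[symmetric])
  then show "finite ({1..} - hitting_times (gen_backward_shift \<psi>) U W)"
    using finite_subset by blast
qed

lemma mixing_imp_transitive: "mixing_on X T \<Longrightarrow> transitive_on X T"
  unfolding mixing_on_def transitive_on_def
  using infinite_Ici[of "1::nat"] by (metis Diff_empty)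


section \<open>Periodic points\<close>

lemma summable_bij_real_iff:
  fixes f :: "nat \<Rightarrow> real"
  assumes "bij s" "\<And>j. 0 \<le> f j"
  shows "summable (\<lambda>n. f (s n)) \<longleftrightarrow> summable f"
proof -
  have "summable (\<lambda>n. f (s n)) \<longleftrightarrow> (\<lambda>n. f (s n)) summable_on UNIV"
    using assms(2) by (subst summable_on_UNIV_nonneg_real_iff) auto
  also have "\<dots> \<longleftrightarrow> f summable_on UNIV"
    using assms(1) by (rule summable_on_reindex_bij_betw)
  also have "\<dots> \<longleftrightarrow> summable f"
    using assms(2) by (subst summable_on_UNIV_nonneg_real_iff) auto
  finally show ?thesis .
qed

lemma periodic_points_dense:
  fixes \<psi> :: "nat \<Rightarrow> nat" and \<alpha> :: "nat \<Rightarrow> real" and U :: "(nat \<Rightarrow> 'k::real_normed_field) set"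
  assumes sym: "is_symbol \<psi>" and nn: "\<And>j. 0 \<le> \<alpha> j"
    and l: "summable (\<lambda>j. exp (- l * \<alpha> j))"
    and U: "openin (dual_topology \<alpha>) U" "U \<noteq> {}"
  shows "\<exists>x\<in>U. \<exists>N\<ge>1. (gen_backward_shift \<psi> ^^ N) x = x"
proof -
  define s where "s n = (\<psi> ^^ n) 0" for n
  have bs: "bij s" using bij_symbol_orbit[OF sym] by (simp add: s_def[abs_def])
  then have inj: "inj s" and surj: "surj s" by (auto simp: bij_def)
  obtain u where u: "u \<in> U" "finite {j. u j \<noteq> 0}" using finite_support_dense[OF nn U] .
  obtain K where K: "\<And>i. i \<ge> K \<Longrightarrow> u (s i) = 0" by (rule finite_support_orbit[OF bs u(2)]) blast
  obtain m :: nat where m: "m \<ge> 1" "real m \<ge> l"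
    using real_arch_simple[of "max 1 l"] by auto
  obtain M where M: "\<And>j. norm (u j) \<le> M"
  proof
    fix j
    show "norm (u j) \<le> (\<Sum>i | u i \<noteq> 0. norm (u i))"
      using u(2) by (cases "u j = 0") (auto intro: member_le_sum sum_nonneg)
  qed
  \<comment> \<open>All periodizations of \<open>u\<close> are bounded by \<open>M\<close>, which gives a common majorant in step \<open>m\<close>.\<close>
  define f where "f j = M\<^sup>2 * exp (- 2 * real m * \<alpha> j)" for j
  have "exp (- 2 * real m * \<alpha> j) \<le> exp (- l * \<alpha> j)" for j
    using mult_right_mono[of l "2 * real m" "\<alpha> j"] nn[of j] m by simp
  then have "summable (\<lambda>j. exp (- 2 * real m * \<alpha> j))"
    by (intro summable_comparison_test'[OF l]) auto
  then have f: "f summable_on UNIV"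
    unfolding f_def by (subst summable_on_UNIV_nonneg_real_iff) (auto intro: summable_mult)
  obtain F where F: "finite F"
    "\<And>z. (\<And>j. (norm (z j))\<^sup>2 * exp (- 2 * real m * \<alpha> j) \<le> f j) \<Longrightarrow>
       (\<And>j. j \<in> F \<Longrightarrow> z j = 0) \<Longrightarrow> (\<lambda>j. u j + z j) \<in> U"
    by (rule dual_open_dominated[OF nn U(1) u(1) finite_support_in_dual_step[OF u(2)] m(1) f])
      (auto simp: f_def)
  obtain N0 where N0: "\<And>n. s n \<in> F \<Longrightarrow> n < N0"
    using finite_vimageI[OF F(1) inj] finite_nat_set_iff_bounded by (metis vimageI)
  define N where "N = Suc (max K N0)"
  have N: "N \<ge> 1" "K \<le> N" "N0 \<le> N" by (auto simp: N_def)
  define y where "y j = u (s (inv s j mod N))" for j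
  have y_s: "y (s n) = u (s (n mod N))" for n by (simp add: y_def inj inv_f_f)
  define z where "z j = y j - u j" for j
  have z_s: "z (s n) = (if n < N then 0 else y (s n))" for n
    using K[of n] N by (simp add: z_def y_s)
  have "(\<lambda>j. u j + z j) \<in> U"
  proof (rule F(2))
    fix j
    obtain n where n: "j = s n" using surj by blast
    have "0 \<le> M" using M[of 0] norm_ge_zero order_trans by blast
    then have "norm (z j) \<le> M" using M by (simp add: n z_s y_s)
    then show "(norm (z j))\<^sup>2 * exp (- 2 * real m * \<alpha> j) \<le> f j"
      by (simp add: f_def power_mono)
    show "z j = 0" if "j \<in> F" using N0[of n] N that by (simp add: n z_s)
  qed
  then have "y \<in> U" by (simp add: z_def)
  moreover have "(gen_backward_shift \<psi> ^^ N) y j = y j" for j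
  proof -
    obtain n where n: "j = s n" using surj by blast
    have "(\<psi> ^^ N) j = s (n + N)" unfolding n s_def by (simp add: funpow_add add.commute[of n])
    then show ?thesis by (simp add: gen_backward_shift_funpow n y_s)
  qed
  ultimately show ?thesis using N(1) by blast
qed


section \<open>Growth of the exponents along the orbit\<close>

text \<open>
  Quantitative form of the invariance of the dual space under the shift.  Continuity of the shift
  from the first step into a step \<open>n\<close>, tested on unit vectors, would give
  \<open>\<alpha> (\<psi> j) \<le> n * \<alpha> j + c\<close>; such an estimate is obtained here by a gliding hump, without a closed
  graph theorem, and \<open>\<alpha> j \<ge> \<alpha> 0 > 0\<close> then absorbs the constant.
\<close>

lemma symbol_growth:
  fixes \<psi> :: "nat \<Rightarrow> nat" and \<alpha> :: "nat \<Rightarrow> real"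
  assumes inj: "inj \<psi>" and pos: "\<And>j. 0 < \<alpha> j" and bdd: "\<And>j. \<alpha> 0 \<le> \<alpha> j"
    and inv: "\<forall>x \<in> (dual_space \<alpha> :: (nat \<Rightarrow> 'k::real_normed_field) set).
           gen_backward_shift \<psi> x \<in> dual_space \<alpha>"
  obtains A where "A \<ge> 1" "\<And>j. \<alpha> (\<psi> j) \<le> A * \<alpha> j"
proof -
  have "\<exists>n k. \<forall>j\<ge>k. \<alpha> (\<psi> j) \<le> real n * \<alpha> j + real n"
  proof (rule ccontr)
    assume "\<not> ?thesis"
    then have ex: "\<exists>j\<ge>k. \<alpha> (\<psi> j) > real n * \<alpha> j + real n" for n k
      by (meson not_le)
    \<comment> \<open>Otherwise there are indices \<open>f 0 < f 1 < \<dots>\<close> at which \<open>\<alpha> \<circ> \<psi>\<close> outgrows every multiple of \<open>\<alpha>\<close>;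
      an \<open>x\<close> in the first step is concentrated on \<open>range h\<close>, \<open>h = \<psi> \<circ> f\<close>, so that its shift lies in no
      step.  The additive term \<open>real n\<close> beats the factor \<open>1 / Suc n\<close> needed for summability.\<close>
    have "\<exists>f. \<forall>n. \<alpha> (\<psi> (f n)) > real n * \<alpha> (f n) + real n \<and> f n < f (Suc n)"
    proof (rule dependent_nat_choice)
      show "\<exists>j. \<alpha> (\<psi> j) > real 0 * \<alpha> j + real 0" using ex by blast
      show "\<exists>j. \<alpha> (\<psi> j) > real (Suc n) * \<alpha> j + real (Suc n) \<and> i < j" for i n
        using ex[where k = "Suc i" and n = "Suc n"] unfolding Suc_le_eq by blast
    qed
    then obtain f where f: "\<And>n. \<alpha> (\<psi> (f n)) > real n * \<alpha> (f n) + real n" "strict_mono f"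
      by (auto simp: strict_mono_Suc_iff)
    define h where "h n = \<psi> (f n)" for n
    have ih: "inj h"
      using inj_compose[OF inj strict_mono_imp_inj_on[OF f(2)]] by (simp add: h_def[abs_def] o_def)
    define x :: "nat \<Rightarrow> 'k" where
      "x j = (if j \<in> range h then of_real (exp (\<alpha> j) / real (Suc (Hilbert_Choice.inv h j))) else 0)" for j
    have x_h: "x (h n) = of_real (exp (\<alpha> (h n)) / real (Suc n))" for n
      by (simp add: x_def ih inv_f_f)
    have "(\<lambda>j. (norm (x j))\<^sup>2 * exp (- 2 * real 1 * \<alpha> j)) \<circ> h = (\<lambda>n. 1 / (real (Suc n))\<^sup>2)"
    proof
      fix n
      show "((\<lambda>j. (norm (x j))\<^sup>2 * exp (- 2 * real 1 * \<alpha> j)) \<circ> h) n = 1 / (real (Suc n))\<^sup>2"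
        unfolding o_def weight_square x_h norm_of_real
        by (simp add: power_divide flip: exp_add)
    qed
    moreover have "(\<lambda>n. 1 / (real (Suc n))\<^sup>2) summable_on UNIV"
      using inverse_squares_sums by (subst summable_on_UNIV_nonneg_real_iff) (auto simp: sums_iff add.commute)
    ultimately have "(\<lambda>j. (norm (x j))\<^sup>2 * exp (- 2 * real 1 * \<alpha> j)) summable_on range h"
      by (simp only: summable_on_reindex[OF ih])
    moreover have "?this \<longleftrightarrow> (\<lambda>j. (norm (x j))\<^sup>2 * exp (- 2 * real 1 * \<alpha> j)) summable_on UNIV"
      by (rule summable_on_cong_neutral) (auto simp: x_def)
    ultimately have "x \<in> dual_step \<alpha> 1" by (simp add: dual_step_def)
    then have "gen_backward_shift \<psi> x \<in> dual_space \<alpha>" using inv by (auto simp: dual_space_def)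
    then obtain m where "(\<lambda>j. (norm (x (\<psi> j)))\<^sup>2 * exp (- 2 * real m * \<alpha> j)) summable_on UNIV"
      by (auto simp: dual_space_def dual_step_def gen_backward_shift_def)
    then have "(\<lambda>j. (norm (x (\<psi> j)))\<^sup>2 * exp (- 2 * real m * \<alpha> j)) summable_on range f"
      by (rule summable_on_subset_banach) auto
    then have "(\<lambda>n. (norm (x (\<psi> (f n))))\<^sup>2 * exp (- 2 * real m * \<alpha> (f n))) summable_on UNIV"
      by (simp add: summable_on_reindex[OF strict_mono_imp_inj_on[OF f(2)]] o_def)
    then have "summable (\<lambda>n. (norm (x (h n)))\<^sup>2 * exp (- 2 * real m * \<alpha> (f n)))"
      by (subst (asm) summable_on_UNIV_nonneg_real_iff) (auto simp: h_def)
    then have "(\<lambda>n. (norm (x (h n)))\<^sup>2 * exp (- 2 * real m * \<alpha> (f n))) \<longlonglongrightarrow> 0"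
      by (rule summable_LIMSEQ_zero)
    from order_tendstoD(2)[OF this, of 1]
    obtain N where N: "\<And>n. n \<ge> N \<Longrightarrow> (norm (x (h n)))\<^sup>2 * exp (- 2 * real m * \<alpha> (f n)) < 1"
      by (auto simp: eventually_sequentially)
    define n where "n = max N m"
    have "real m * \<alpha> (f n) \<le> real n * \<alpha> (f n)"
      using pos[of "f n"] by (intro mult_right_mono) (auto simp: n_def)
    then have "real n \<le> \<alpha> (h n) - real m * \<alpha> (f n)"
      using f(1)[of n] by (simp add: h_def)
    then have "exp (real n) \<le> exp (\<alpha> (h n) - real m * \<alpha> (f n))" by simp
    moreover have "real (Suc n) \<le> exp (real n)" using exp_ge_add_one_self[of "real n"] by simp
    ultimately have "real (Suc n) \<le> exp (\<alpha> (h n) - real m * \<alpha> (f n))" by linarith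
    then have "1 \<le> exp (\<alpha> (h n) - real m * \<alpha> (f n)) / real (Suc n)"
      by (subst le_divide_eq_1_pos) simp_all
    also have "\<dots> = norm (x (h n)) * exp (- (real m * \<alpha> (f n)))"
      unfolding x_h norm_of_real by (simp add: diff_conv_add_uminus exp_add del: add_uminus_conv_diff)
    finally have "1 \<le> (norm (x (h n)) * exp (- (real m * \<alpha> (f n))))\<^sup>2"
      by (rule one_le_power)
    then show False using N[of n] unfolding weight_square by (simp add: n_def)
  qed
  then obtain n k where nk: "\<And>j. j \<ge> k \<Longrightarrow> \<alpha> (\<psi> j) \<le> real n * \<alpha> j + real n" by blast
  \<comment> \<open>The finitely many indices below \<open>k\<close> are covered by \<open>S\<close>, and the additive term is absorbed
    because \<open>\<alpha>\<close> is bounded below by \<open>\<alpha> 0 > 0\<close>.\<close>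
  define S where "S = (\<Sum>j<k. \<alpha> (\<psi> j) / \<alpha> j)"
  have S0: "S \<ge> 0" unfolding S_def using pos by (intro sum_nonneg) (auto intro: less_imp_le)
  define A where "A = 1 + real n + real n / \<alpha> 0 + S"
  have "\<alpha> (\<psi> j) \<le> A * \<alpha> j" for j
  proof (cases "j < k")
    case True
    have "\<alpha> (\<psi> j) / \<alpha> j \<le> S"
      unfolding S_def using True pos
      by (intro member_le_sum) (auto intro: less_imp_le)
    also have "S \<le> A" using pos[of 0] by (simp add: A_def)
    finally show ?thesis using pos[of j] by (simp add: pos_divide_le_eq)
  next
    case False
    have "real n \<le> real n / \<alpha> 0 * \<alpha> j"
      using mult_left_mono[OF bdd[of j], of "real n"] pos[of 0] by (simp add: field_simps)
    then have "\<alpha> (\<psi> j) \<le> (real n + real n / \<alpha> 0) * \<alpha> j"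
      using nk[of j] False by (simp add: distrib_right)
    also have "\<dots> \<le> A * \<alpha> j"
      using pos[of j] S0 by (intro mult_right_mono) (auto simp: A_def)
    finally show ?thesis .
  qed
  moreover have "A \<ge> 1" using pos[of 0] S0 by (simp add: A_def)
  ultimately show thesis using that by blast
qed

text \<open>
  Summation in blocks of length \<open>N\<close>, each dominated by a single term of \<open>g\<close>.
\<close>

lemma summable_from_progression:
  fixes f g :: "nat \<Rightarrow> real"
  assumes g: "summable g" and g0: "\<And>k. 0 \<le> g k" and f0: "\<And>n. 0 \<le> f n"
    and N: "N \<ge> 1" and le: "\<And>k i. i < N \<Longrightarrow> f (k * N + i) \<le> g (Suc k)"
  shows "summable f"
proof (rule summableI_nonneg_bounded[OF f0])
  fix n
  have "(\<Sum>i<n. f i) \<le> (\<Sum>i<n * N. f i)"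
    using N f0 by (intro sum_mono2) auto
  also have "\<dots> = (\<Sum>k<n. sum f {k * N..<k * N + N})"
    by (rule sum.nat_group[symmetric])
  also have "\<dots> \<le> (\<Sum>k<n. real N * g (Suc k))"
  proof (rule sum_mono)
    fix k
    have "sum f {k * N..<k * N + N} \<le> (\<Sum>i\<in>{k * N..<k * N + N}. g (Suc k))"
    proof (rule sum_mono)
      fix i assume "i \<in> {k * N..<k * N + N}"
      then have "i - k * N < N" "k * N + (i - k * N) = i" by auto
      then show "f i \<le> g (Suc k)" using le by metis
    qed
    then show "sum f {k * N..<k * N + N} \<le> real N * g (Suc k)" by simp
  qed
  also have "\<dots> = real N * (\<Sum>k<n. g (Suc k))" by (simp add: sum_distrib_left)
  also have "\<dots> \<le> real N * (\<Sum>k. g (Suc k))"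
    using g g0 by (intro mult_left_mono sum_le_suminf) (auto simp: summable_Suc_iff)
  finally show "(\<Sum>i<n. f i) \<le> real N * (\<Sum>k. g (Suc k))" .
qed

lemma periodic_point_imp_summable:
  fixes \<psi> :: "nat \<Rightarrow> nat" and \<alpha> :: "nat \<Rightarrow> real" and x :: "nat \<Rightarrow> 'k::real_normed_field"
  assumes sym: "is_symbol \<psi>" and pos: "\<And>j. 0 < \<alpha> j"
    and A: "A \<ge> 1" "\<And>j. \<alpha> (\<psi> j) \<le> A * \<alpha> j"
    and x: "x \<in> dual_space \<alpha>" "x 0 \<noteq> 0" and N: "N \<ge> 1" "(gen_backward_shift \<psi> ^^ N) x = x"
  shows "\<exists>l>0. summable (\<lambda>j. exp (- l * \<alpha> j))"
proof -
  define s where "s n = (\<psi> ^^ n) 0" for n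
  have bs: "bij s" using bij_symbol_orbit[OF sym] by (simp add: s_def[abs_def])
  have x_s: "x (s (k * N)) = x 0" for k
  proof -
    have "(gen_backward_shift \<psi> ^^ (k * N)) x = x"
    proof (induction k)
      case (Suc k)
      then show ?case using N(2) by (simp add: funpow_add)
    qed simp
    then show ?thesis by (metis gen_backward_shift_funpow s_def)
  qed
  obtain m where m: "m \<ge> 1" "(\<lambda>j. (norm (x j))\<^sup>2 * exp (- 2 * real m * \<alpha> j)) summable_on UNIV"
    using x(1) by (auto simp: dual_space_def dual_step_def)
  have inj: "inj (\<lambda>k. s (k * N))"
    using bs N(1) by (auto simp: bij_def intro!: injI dest!: injD[of s])
  have "(\<lambda>j. (norm (x j))\<^sup>2 * exp (- 2 * real m * \<alpha> j)) summable_on range (\<lambda>k. s (k * N))"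
    using m(2) by (rule summable_on_subset_banach) auto
  then have "(\<lambda>k. (norm (x 0))\<^sup>2 * exp (- 2 * real m * \<alpha> (s (k * N)))) summable_on UNIV"
    by (simp add: summable_on_reindex[OF inj] o_def x_s)
  then have "summable (\<lambda>k. (norm (x 0))\<^sup>2 * exp (- 2 * real m * \<alpha> (s (k * N))))"
    by (subst (asm) summable_on_UNIV_nonneg_real_iff) auto
  then have g: "summable (\<lambda>k. exp (- 2 * real m * \<alpha> (s (k * N))))"
    using x(2) by (simp add: summable_cmult_iff)
  have pow: "\<alpha> ((\<psi> ^^ i) j) \<le> A ^ i * \<alpha> j" for i j
  proof (induction i)
    case (Suc i)
    have "\<alpha> ((\<psi> ^^ Suc i) j) \<le> A * \<alpha> ((\<psi> ^^ i) j)" using A(2) by simp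
    also have "\<dots> \<le> A * (A ^ i * \<alpha> j)" using Suc A(1) by (intro mult_left_mono) auto
    finally show ?case by simp
  qed simp
  define l where "l = 2 * real m * A ^ N"
  have "summable (\<lambda>n. exp (- l * \<alpha> (s n)))"
  proof (rule summable_from_progression[OF g _ _ N(1)])
    fix k i assume i: "i < N"
    \<comment> \<open>The next multiple of \<open>N\<close> is reached from \<open>k * N + i\<close> in at most \<open>N\<close> steps.\<close>
    have "s (Suc k * N) = (\<psi> ^^ (N - i)) (s (k * N + i))"
    proof -
      have "Suc k * N = (N - i) + (k * N + i)" using i by simp
      then show ?thesis unfolding s_def by (metis comp_apply funpow_add)
    qed
    then have "\<alpha> (s (Suc k * N)) \<le> A ^ (N - i) * \<alpha> (s (k * N + i))" using pow by metis
    also have "\<dots> \<le> A ^ N * \<alpha> (s (k * N + i))"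
      using A(1) pos[of "s (k * N + i)"] by (intro mult_right_mono power_increasing) auto
    finally have "2 * real m * \<alpha> (s (Suc k * N)) \<le> 2 * real m * (A ^ N * \<alpha> (s (k * N + i)))"
      by (intro mult_left_mono) auto
    then show "exp (- l * \<alpha> (s (k * N + i))) \<le> exp (- 2 * real m * \<alpha> (s (Suc k * N)))"
      by (simp add: l_def mult.assoc)
  qed auto
  then have "summable (\<lambda>j. exp (- l * \<alpha> j))"
    using summable_bij_real_iff[OF bs, of "\<lambda>j. exp (- l * \<alpha> j)"] by simp
  moreover have "l > 0" using m(1) A(1) by (simp add: l_def)
  ultimately show ?thesis by blast
qed


section \<open>The characterization of chaos\<close>

theorem corollary4p1:
  fixes \<psi> :: "nat \<Rightarrow> nat" and \<alpha> :: "nat \<Rightarrow> real"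
  assumes "is_symbol \<psi>"
    and "mono \<alpha>" and "\<forall>j. 0 < \<alpha> j" and "filterlim \<alpha> at_top sequentially"
    and "\<forall>x \<in> (dual_space \<alpha> :: (nat \<Rightarrow> 'k::real_normed_field) set).
           gen_backward_shift \<psi> x \<in> dual_space \<alpha>"
  shows "mixing_on (dual_topology \<alpha> :: (nat \<Rightarrow> 'k) topology) (gen_backward_shift \<psi>) \<and>
         (chaotic_on (dual_topology \<alpha> :: (nat \<Rightarrow> 'k) topology) (gen_backward_shift \<psi>) \<longleftrightarrow>
            (\<exists>l::real. l > 0 \<and> summable (\<lambda>j. exp (- l * \<alpha> j))))"
proof -
  let ?X = "dual_topology \<alpha> :: (nat \<Rightarrow> 'k) topology" and ?B = "gen_backward_shift \<psi>"
  let ?P = "{x \<in> topspace ?X. \<exists>N\<ge>1. (?B ^^ N) x = x}"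
  have pos: "0 < \<alpha> j" and nn: "0 \<le> \<alpha> j" and bdd: "\<alpha> 0 \<le> \<alpha> j" for j
    using assms(2,3) by (auto simp: less_imp_le monoD)
  have mix: "mixing_on ?X ?B"
    by (rule gen_backward_shift_mixing[OF assms(1) nn assms(4)])
  have "?X closure_of ?P = topspace ?X \<longleftrightarrow> (\<exists>l>0. summable (\<lambda>j. exp (- l * \<alpha> j)))"
  proof
    assume dense: "?X closure_of ?P = topspace ?X"
    have one: "(\<lambda>j. if j = 0 then 1 else 0) \<in> {x \<in> dual_space \<alpha>. x 0 \<noteq> (0 :: 'k)}"
      using finite_support_in_dual_step[of "\<lambda>j. if j = 0 then 1 else (0 :: 'k)" \<alpha> 1]
      by (auto simp: dual_space_def intro!: bexI[of _ 1])
    have "?P \<inter> {x \<in> dual_space \<alpha>. x 0 \<noteq> 0} \<noteq> {}"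
      using dense one openin_coordinate_nonzero[of \<alpha> 0, where 'k='k, OF nn]
      unfolding dense_intersects_open by blast
    then obtain x :: "nat \<Rightarrow> 'k" and N where x: "x \<in> dual_space \<alpha>" "x 0 \<noteq> 0" "N \<ge> 1" "(?B ^^ N) x = x"
      by blast
    have "inj \<psi>" using assms(1) by (auto simp: is_symbol_def bij_betw_def)
    then obtain A where "A \<ge> 1" "\<And>j. \<alpha> (\<psi> j) \<le> A * \<alpha> j"
      using symbol_growth[OF _ pos bdd assms(5)] by blast
    then show "\<exists>l>0. summable (\<lambda>j. exp (- l * \<alpha> j))"
      by (rule periodic_point_imp_summable[OF assms(1) pos _ _ x])
  next
    assume "\<exists>l>0. summable (\<lambda>j. exp (- l * \<alpha> j))"
    then obtain l where l: "summable (\<lambda>j. exp (- l * \<alpha> j))" by blast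
    show "?X closure_of ?P = topspace ?X"
      unfolding dense_intersects_open
    proof (intro allI impI)
      fix U assume "openin ?X U \<and> U \<noteq> {}"
      then show "?P \<inter> U \<noteq> {}"
        using periodic_points_dense[OF assms(1) nn l, of U] openin_subset[of ?X U] by blast
    qed
  qed
  then show ?thesis
    using mix mixing_imp_transitive[OF mix] by (simp add: chaotic_on_def)
qed

end
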